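(* The quotient spaces $C_P=[-1,1]^2/\!\sim_{CP}$ and $S=\mathcal{S}^2/\!\sim_{sym}$ (each with the quotient topology) are homeomorphic.
   Context: On the square $[-1,1]^2$ (fundamental polygon of the real projective plane) the equivalence relation $\sim_{CP}$ is defined by: $(x,y)\sim_{CP}(x',y')$ if and only if either ($x\in\{-1,1\}$ or $y\in\{-1,1\}$) and $(x',y')=\pm(x,y)$, or (neither $x$ nor $y$ is in $\{-1,1\}$) and $(x',y')=(x,y)$. $\mathcal{S}^2=\{(x,y,z)\in\mathbb{R}^3: x^2+y^2+z^2=1\}$ is the unit sphere, and $\sim_{sym}$ is the antipodal relation: $a\sim_{sym}a'$ if and only if $a'=\pm a$. *)

theory Defs
  imports "HOL-Analysis.Analysis"
begin

text \<open>The quotient topology on the set of classes \<open>topspace X // r\<close>: the finest topology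
  making the projection \<open>x \<mapsto> r `` {x}\<close> continuous.\<close>

definition quotient_topology :: "'a topology \<Rightarrow> ('a \<times> 'a) set \<Rightarrow> 'a set topology" where
  "quotient_topology X r =
     topology (\<lambda>U. U \<subseteq> topspace X // r \<and> openin X {x \<in> topspace X. r `` {x} \<in> U})"

lemma openin_quotient_topology:
  "openin (quotient_topology X r) U \<longleftrightarrow>
     U \<subseteq> topspace X // r \<and> openin X {x \<in> topspace X. r `` {x} \<in> U}"
proof -
  have "istopology (\<lambda>U. U \<subseteq> topspace X // r \<and> openin X {x \<in> topspace X. r `` {x} \<in> U})"
    unfolding istopology_def
  proof (intro conjI allI impI; (elim conjE)?)
    fix S T
    assume S: "openin X {x \<in> topspace X. r `` {x} \<in> S}"
      and T: "openin X {x \<in> topspace X. r `` {x} \<in> T}"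
    have "{x \<in> topspace X. r `` {x} \<in> S \<inter> T} =
        {x \<in> topspace X. r `` {x} \<in> S} \<inter> {x \<in> topspace X. r `` {x} \<in> T}"
      by auto
    then show "openin X {x \<in> topspace X. r `` {x} \<in> S \<inter> T}"
      using S T by (simp add: openin_Int)
  next
    fix K
    assume K: "\<forall>U\<in>K. U \<subseteq> topspace X // r \<and> openin X {x \<in> topspace X. r `` {x} \<in> U}"
    have "{x \<in> topspace X. r `` {x} \<in> \<Union>K} = (\<Union>U\<in>K. {x \<in> topspace X. r `` {x} \<in> U})"
      by auto
    then show "openin X {x \<in> topspace X. r `` {x} \<in> \<Union>K}"
      using K by (auto intro!: openin_Union)
  qed blast+
  then show ?thesis
    by (simp add: quotient_topology_def topology_inverse')
qed

lemma topspace_quotient_topology [simp]: "topspace (quotient_topology X r) = topspace X // r"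
proof -
  have "{x \<in> topspace X. r `` {x} \<in> topspace X // r} = topspace X"
    by (auto intro: quotientI)
  then have "openin (quotient_topology X r) (topspace X // r)"
    by (simp add: openin_quotient_topology)
  then show ?thesis
    by (meson openin_quotient_topology openin_subset openin_topspace subset_antisym)
qed

lemma quotient_map_quotient_topology:
  "quotient_map X (quotient_topology X r) (\<lambda>x. r `` {x})"
  by (auto simp: quotient_map_def openin_quotient_topology quotient_def)

definition square :: "(real \<times> real) set" where
  "square = {-1..1} \<times> {-1..1}"

definition CP_rel :: "((real \<times> real) \<times> (real \<times> real)) set" where
  "CP_rel = {((x, y), (x', y')). (x, y) \<in> square \<and> (x', y') \<in> square \<and>
     ((x \<in> {-1, 1} \<or> y \<in> {-1, 1}) \<and> ((x', y') = (x, y) \<or> (x', y') = - (x, y)) \<or>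
      \<not> (x \<in> {-1, 1} \<or> y \<in> {-1, 1}) \<and> (x', y') = (x, y))}"

definition unit_sphere :: "(real \<times> real \<times> real) set" where
  "unit_sphere = {(x, y, z). x\<^sup>2 + y\<^sup>2 + z\<^sup>2 = 1}"

definition sym_rel :: "((real \<times> real \<times> real) \<times> (real \<times> real \<times> real)) set" where
  "sym_rel = {(a, a'). a \<in> unit_sphere \<and> a' \<in> unit_sphere \<and> (a' = a \<or> a' = - a)}"

lemma equiv_CP_rel: "equiv square CP_rel"
  by (rule equivI) (auto simp: CP_rel_def square_def refl_on_def sym_def trans_def)

lemma equiv_sym_rel: "equiv unit_sphere sym_rel"
  by (rule equivI) (auto simp: sym_rel_def unit_sphere_def refl_on_def sym_def trans_def)

definition C_P :: "(real \<times> real) set topology" where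
  "C_P = quotient_topology (top_of_set square) CP_rel"

definition S_sym :: "(real \<times> real \<times> real) set topology" where
  "S_sym = quotient_topology (top_of_set unit_sphere) sym_rel"

end

theory Submission
  imports Defs
begin

text \<open>
  Raise the square to a pyramid of height one: the point \<open>(x, y)\<close> goes to
  \<open>(x, y, 1 - max \<bar>x\<bar> \<bar>y\<bar>)\<close>, so the centre becomes the apex and the boundary of the
  square stays at height zero. The pyramid misses the origin, and radial projection carries it onto
  the closed upper hemisphere, the boundary of the square going to the equator.

  Every antipodal pair of the sphere meets the closed upper hemisphere, and it meets it twice
  exactly when it lies on the equator. Hence two points of the square are sent to the same
  antipodal pair only if they are equal, or are opposite points of the boundary; this is precisely
  \<open>CP_rel\<close> (lemma \<open>hemisphere_map_sym_rel_iff\<close>). The composite of the hemisphere map with the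
  projection onto \<open>S_sym\<close> is therefore a continuous surjection whose fibres are the classes of
  \<open>CP_rel\<close>. It is also a closed map, because the square is compact and because the
  antipodal projection is closed: the saturation of a closed set is its union with its antipodal
  image. So it is a quotient map, and a quotient map identifies its target with the quotient of its source by its
  fibres (lemma \<open>quotient_topology_homeomorphic_space\<close>).
\<close>

section \<open>Quotient spaces\<close>

text \<open>The induced map on classes is itself a quotient map, since its composite with the projection
  is one; and the fibre condition makes it injective. An injective quotient map is a
  homeomorphism.\<close>

lemma quotient_topology_homeomorphic_space:
  assumes r: "equiv (topspace X) r"
    and q: "quotient_map X Y q"
    and fibres: "\<And>x y. \<lbrakk>x \<in> topspace X; y \<in> topspace X\<rbrakk> \<Longrightarrow> q x = q y \<longleftrightarrow> (x, y) \<in> r"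
  shows "quotient_topology X r homeomorphic_space Y"
proof -
  let ?p = "\<lambda>x. r `` {x}"
  have p: "quotient_map X (quotient_topology X r) ?p"
    by (rule quotient_map_quotient_topology)
  have same_class: "?p x = ?p y \<longleftrightarrow> q x = q y" if "x \<in> topspace X" "y \<in> topspace X" for x y
    using eq_equiv_class_iff[OF r that] fibres[OF that] by simp
  obtain h where h: "continuous_map (quotient_topology X r) Y h"
    and hp: "\<And>x. x \<in> topspace X \<Longrightarrow> h (?p x) = q x"
    by (rule quotient_map_lift_exists[OF p quotient_imp_continuous_map[OF q]])
      (use same_class that in blast)+
  have "quotient_map X Y (h \<circ> ?p)"
    by (rule quotient_map_eq[OF q]) (simp add: hp)
  then have "quotient_map (quotient_topology X r) Y h"
    using quotient_map_from_composition quotient_imp_continuous_map[OF p] h by blast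
  moreover have "inj_on h (topspace (quotient_topology X r))"
    unfolding topspace_quotient_topology
  proof (rule inj_onI)
    fix c d assume "c \<in> topspace X // r" "d \<in> topspace X // r" and eq: "h c = h d"
    then obtain x y where "x \<in> topspace X" "c = ?p x" "y \<in> topspace X" "d = ?p y"
      by (auto elim!: quotientE)
    then show "c = d"
      using eq hp same_class by metis
  qed
  ultimately have "homeomorphic_map (quotient_topology X r) Y h"
    by (simp add: homeomorphic_map_def)
  then show ?thesis
    by (rule homeomorphic_map_imp_homeomorphic_space)
qed

text \<open>A set of classes is closed iff its preimage is, and the preimage of the image of \<open>C\<close> is the
  saturation of \<open>C\<close>.\<close>

lemma closed_map_quotient_projection:
  assumes r: "equiv (topspace X) r"
    and saturation: "\<And>C. closedin X C \<Longrightarrow> closedin X (r `` C)"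
  shows "closed_map X (quotient_topology X r) (\<lambda>x. r `` {x})"
  unfolding closed_map_def
proof (intro allI impI)
  fix C assume C: "closedin X C"
  let ?p = "\<lambda>x. r `` {x}"
  have CX: "C \<subseteq> topspace X"
    using C by (rule closedin_subset)
  have "{x \<in> topspace X. ?p x \<in> ?p ` C} = r `` C"
  proof (intro equalityI subsetI)
    fix x assume "x \<in> {x \<in> topspace X. ?p x \<in> ?p ` C}"
    then obtain c where "x \<in> topspace X" "c \<in> C" "?p c = ?p x" by auto
    then show "x \<in> r `` C"
      using eq_equiv_class[OF _ r] by fastforce
  next
    fix x assume "x \<in> r `` C"
    then obtain c where "c \<in> C" "(c, x) \<in> r" by auto
    then show "x \<in> {x \<in> topspace X. ?p x \<in> ?p ` C}"
      using equiv_class_eq[OF r] equiv_class_eq_iff[OF r] by blast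
  qed
  moreover have "?p ` C \<subseteq> topspace (quotient_topology X r)"
    using CX by (auto intro: quotientI)
  then have "closedin X {x \<in> topspace X. ?p x \<in> ?p ` C} \<longleftrightarrow>
      closedin (quotient_topology X r) (?p ` C)"
    using quotient_map_quotient_topology[of X r] unfolding quotient_map_closedin by blast
  ultimately show "closedin (quotient_topology X r) (?p ` C)"
    using saturation[OF C] by simp
qed

section \<open>Antipodal classes on the sphere\<close>

lemma unit_sphere_eq: "unit_sphere = sphere 0 1"
  by (auto simp: unit_sphere_def norm_Pair real_sqrt_eq_1_iff add.assoc)

lemma closed_map_antipodal_projection:
  "closed_map (top_of_set unit_sphere) S_sym (\<lambda>a. sym_rel `` {a})"
  unfolding S_sym_def
proof (rule closed_map_quotient_projection)
  show "equiv (topspace (top_of_set unit_sphere)) sym_rel"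
    by (simp add: equiv_sym_rel)
next
  fix C assume C: "closedin (top_of_set unit_sphere) C"
  have closed_sphere: "closed unit_sphere"
    by (simp add: unit_sphere_eq)
  then have "closed C" and CS: "C \<subseteq> unit_sphere"
    using C by (auto simp: closedin_closed_eq)
  then have "closed (C \<union> uminus ` C)"
    by (simp add: closed_Un closed_negations)
  moreover have "sym_rel `` {a} = {a, - a}" if "a \<in> C" for a
    using that CS by (auto simp: sym_rel_def unit_sphere_eq)
  then have "sym_rel `` C = (\<Union>a\<in>C. {a, - a})"
    by (subst Image_eq_UN) simp
  then have "sym_rel `` C = C \<union> uminus ` C"
    by blast
  moreover have "sym_rel `` C \<subseteq> unit_sphere"
    by (auto simp: sym_rel_def)
  ultimately show "closedin (top_of_set unit_sphere) (sym_rel `` C)"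
    using closed_sphere by (simp add: closedin_closed_eq)
qed

section \<open>From the square to the upper hemisphere\<close>

definition max_norm :: "real \<times> real \<Rightarrow> real" where
  "max_norm p = max \<bar>fst p\<bar> \<bar>snd p\<bar>"

definition pyramid :: "real \<times> real \<Rightarrow> real \<times> real \<times> real" where
  "pyramid p = (fst p, snd p, 1 - max_norm p)"

definition hemisphere_map :: "real \<times> real \<Rightarrow> real \<times> real \<times> real" where
  "hemisphere_map p = pyramid p /\<^sub>R norm (pyramid p)"

lemma square_iff_max_norm: "p \<in> square \<longleftrightarrow> max_norm p \<le> 1"
  by (cases p) (auto simp: square_def max_norm_def)

lemma max_norm_scaleR: "max_norm (t *\<^sub>R p) = \<bar>t\<bar> * max_norm p"
  by (simp add: max_norm_def abs_mult max_mult_distrib_left)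

lemma CP_rel_iff:
  "(p, q) \<in> CP_rel \<longleftrightarrow> p \<in> square \<and> q \<in> square \<and> (q = p \<or> max_norm p = 1 \<and> q = - p)"
  by (cases p; cases q) (auto simp: CP_rel_def square_def max_norm_def max_def abs_if split: if_splits)

lemma pyramid_nonzero: "pyramid p \<noteq> 0"
  by (auto simp: pyramid_def max_norm_def prod_eq_iff)

lemma hemisphere_map_in_sphere: "hemisphere_map p \<in> unit_sphere"
  by (simp add: hemisphere_map_def unit_sphere_eq pyramid_nonzero)

lemma continuous_on_hemisphere_map: "continuous_on A hemisphere_map"
proof -
  have "continuous_on A pyramid"
    unfolding pyramid_def max_norm_def by (intro continuous_intros)
  then show ?thesis
    unfolding hemisphere_map_def by (intro continuous_intros) (auto simp: pyramid_nonzero)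
qed

text \<open>A line through the origin meets the pyramid once, or else twice in opposite points of its
  rim. Comparing the first two coordinates gives \<open>max_norm p = \<bar>t\<bar> * max_norm q\<close>, and comparing
  heights gives \<open>1 - max_norm p = t * (1 - max_norm q)\<close>. For \<open>t \<ge> 0\<close> the sum of these is
  \<open>t = 1\<close>; for \<open>t < 0\<close> both heights vanish, as neither is negative.\<close>

lemma pyramid_collinear:
  assumes "p \<in> square" "q \<in> square" and eq: "pyramid p = t *\<^sub>R pyramid q"
  shows "q = p \<or> max_norm p = 1 \<and> q = - p"
proof -
  have pq: "p = t *\<^sub>R q" and height: "1 - max_norm p = t * (1 - max_norm q)"
    using eq by (auto simp: pyramid_def prod_eq_iff)
  have norm: "max_norm p = \<bar>t\<bar> * max_norm q"
    by (simp add: pq max_norm_scaleR)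
  have le: "max_norm p \<le> 1" "max_norm q \<le> 1"
    using assms by (auto simp: square_iff_max_norm)
  show ?thesis
  proof (cases "t \<ge> 0")
    case True
    then have "t = 1"
      using norm height by (simp add: algebra_simps)
    then show ?thesis
      using pq by simp
  next
    case False
    then have "t * (1 - max_norm q) \<le> 0"
      using le by (simp add: mult_nonpos_nonneg)
    then have p1: "max_norm p = 1"
      using height le by linarith
    then have "max_norm q = 1"
      using height False by simp
    then have "t = -1"
      using norm p1 False by simp
    then show ?thesis
      using pq p1 by simp
  qed
qed

lemma hemisphere_map_sym_rel_iff:
  assumes "p \<in> square" "q \<in> square"
  shows "(hemisphere_map p, hemisphere_map q) \<in> sym_rel \<longleftrightarrow> (p, q) \<in> CP_rel"
proof
  assume "(hemisphere_map p, hemisphere_map q) \<in> sym_rel"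
  then have "hemisphere_map p = 1 *\<^sub>R hemisphere_map q \<or>
      hemisphere_map p = (-1) *\<^sub>R hemisphere_map q"
    by (auto simp: sym_rel_def)
  then obtain s :: real where s: "hemisphere_map p = s *\<^sub>R hemisphere_map q"
    by blast
  have "pyramid p = norm (pyramid p) *\<^sub>R hemisphere_map p"
    by (simp add: hemisphere_map_def pyramid_nonzero)
  also have "\<dots> = (norm (pyramid p) * s / norm (pyramid q)) *\<^sub>R pyramid q"
    unfolding s by (simp add: hemisphere_map_def divide_inverse)
  finally show "(p, q) \<in> CP_rel"
    using pyramid_collinear assms by (simp add: CP_rel_iff)
next
  assume "(p, q) \<in> CP_rel"
  then consider "q = p" | "max_norm p = 1" "q = - p"
    by (auto simp: CP_rel_iff)
  then show "(hemisphere_map p, hemisphere_map q) \<in> sym_rel"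
  proof cases
    case 1
    then show ?thesis
      by (simp add: sym_rel_def hemisphere_map_in_sphere)
  next
    case 2
    then have "pyramid q = - pyramid p"
      by (simp add: pyramid_def max_norm_def)
    then have "hemisphere_map q = - hemisphere_map p"
      by (simp add: hemisphere_map_def)
    then show ?thesis
      using hemisphere_map_in_sphere[of p] hemisphere_map_in_sphere[of q]
      by (simp add: sym_rel_def)
  qed
qed

text \<open>The ray through a point \<open>(x, y, z)\<close> of the upper hemisphere meets the pyramid where the
  first two coordinates are scaled by \<open>1 / (z + max_norm (x, y))\<close>: that factor makes the height and
  the maximum norm add up to one.\<close>

lemma hemisphere_map_surj:
  assumes a: "a \<in> unit_sphere" and upper: "snd (snd a) \<ge> 0"
  shows "\<exists>p\<in>square. hemisphere_map p = a"
proof -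
  define w where "w = (fst a, fst (snd a))"
  define z where "z = snd (snd a)"
  define m where "m = z + max_norm w"
  have a_eq: "a = (fst w, snd w, z)"
    by (simp add: w_def z_def)
  have z: "z \<ge> 0" and w: "max_norm w \<ge> 0"
    using upper by (auto simp: z_def max_norm_def)
  have "m \<noteq> 0"
  proof
    assume "m = 0"
    then have "z = 0" "max_norm w = 0"
      using z w by (auto simp: m_def)
    then have "a = 0"
      by (auto simp: a_eq max_norm_def max_def zero_prod_def split: if_splits)
    then show False
      using a by (simp add: unit_sphere_eq)
  qed
  then have m: "m > 0"
    using z w by (simp add: m_def)
  let ?p = "inverse m *\<^sub>R w"
  have norm: "max_norm ?p = max_norm w / m"
    using m by (simp add: max_norm_scaleR divide_inverse mult.commute)
  have "?p \<in> square"
    unfolding square_iff_max_norm norm using m z by (simp add: m_def)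
  moreover have "pyramid ?p = inverse m *\<^sub>R a"
    unfolding pyramid_def norm a_eq using m by (simp add: field_simps) (simp add: m_def)
  then have "hemisphere_map ?p = a"
    using m a by (simp add: hemisphere_map_def unit_sphere_eq)
  ultimately show ?thesis
    by blast
qed

lemma hemisphere_map_meets_antipodal_class:
  assumes a: "a \<in> unit_sphere"
  shows "\<exists>p\<in>square. (hemisphere_map p, a) \<in> sym_rel"
proof (cases "snd (snd a) \<ge> 0")
  case True
  then show ?thesis
    using hemisphere_map_surj[OF a] a by (auto simp: sym_rel_def)
next
  case False
  then have "- a \<in> unit_sphere" "snd (snd (- a)) \<ge> 0"
    using a by (auto simp: unit_sphere_eq)
  then show ?thesis
    using hemisphere_map_surj[of "- a"] a by (force simp: sym_rel_def)
qed

section \<open>The projective plane\<close>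

text \<open>Both factors are closed maps: the hemisphere map because a compact space is mapped to a
  Hausdorff one, the antipodal projection by \<open>closed_map_antipodal_projection\<close>.\<close>

lemma quotient_map_square_to_antipodal_classes:
  "quotient_map (top_of_set square) S_sym (\<lambda>p. sym_rel `` {hemisphere_map p})"
proof -
  let ?P = "\<lambda>a. sym_rel `` {a}"
  have P: "quotient_map (top_of_set unit_sphere) S_sym ?P"
    unfolding S_sym_def by (rule quotient_map_quotient_topology)
  have h: "continuous_map (top_of_set square) (top_of_set unit_sphere) hemisphere_map"
    using continuous_on_hemisphere_map hemisphere_map_in_sphere by auto
  have "compact square"
    unfolding square_def by (intro compact_Times compact_Icc)
  then have closed: "closed_map (top_of_set square) (top_of_set unit_sphere) hemisphere_map"
    using h by (intro T1_Spaces.continuous_imp_closed_map)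
      (auto simp: compact_space_subtopology Hausdorff_space_subtopology)
  have surj: "(?P \<circ> hemisphere_map) ` square = topspace S_sym"
  proof (intro equalityI subsetI)
    fix c assume "c \<in> (?P \<circ> hemisphere_map) ` square"
    then show "c \<in> topspace S_sym"
      by (auto simp: S_sym_def hemisphere_map_in_sphere intro: quotientI)
  next
    fix c assume "c \<in> topspace S_sym"
    then obtain a where a: "a \<in> unit_sphere" "c = ?P a"
      by (auto simp: S_sym_def elim: quotientE)
    then obtain p where "p \<in> square" "(hemisphere_map p, a) \<in> sym_rel"
      using hemisphere_map_meets_antipodal_class by blast
    moreover from this have "c = (?P \<circ> hemisphere_map) p"
      using a equiv_class_eq[OF equiv_sym_rel] by simp
    ultimately show "c \<in> (?P \<circ> hemisphere_map) ` square"
      by blast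
  qed
  have "quotient_map (top_of_set square) S_sym (?P \<circ> hemisphere_map)"
  proof (rule continuous_closed_imp_quotient_map)
    show "continuous_map (top_of_set square) S_sym (?P \<circ> hemisphere_map)"
      using h quotient_imp_continuous_map[OF P] by (rule continuous_map_compose)
    show "closed_map (top_of_set square) S_sym (?P \<circ> hemisphere_map)"
      using closed closed_map_antipodal_projection by (rule closed_map_compose)
  qed (use surj in simp)
  then show ?thesis
    by (simp add: comp_def)
qed

theorem proposition4p1:
  shows "C_P homeomorphic_space S_sym"
  unfolding C_P_def
proof (rule quotient_topology_homeomorphic_space)
  show "equiv (topspace (top_of_set square)) CP_rel"
    by (simp add: equiv_CP_rel)
  show "quotient_map (top_of_set square) S_sym (\<lambda>p. sym_rel `` {hemisphere_map p})"
    by (rule quotient_map_square_to_antipodal_classes)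
next
  fix p q assume "p \<in> topspace (top_of_set square)" "q \<in> topspace (top_of_set square)"
  then show "sym_rel `` {hemisphere_map p} = sym_rel `` {hemisphere_map q} \<longleftrightarrow> (p, q) \<in> CP_rel"
    using eq_equiv_class_iff[OF equiv_sym_rel hemisphere_map_in_sphere hemisphere_map_in_sphere]
      hemisphere_map_sym_rel_iff by simp
qed

end
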